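(* For every positive integer $n$: (a) $M_2(S_n\times S_n)\ge (n-1)!$; (b) $M_{2,n}(S_n\times S_n)\ge n!$; (c) $M_2(A_n\times A_n)\ge (n-1)!/2$; (d) $M_{2,n}(A_n\times A_n)\ge n!/2$.
   Context: For a group $\Gamma$ and positive integers $k,g$, a set $A\subseteq\Gamma$ is an $S_k[g]$-set if for every $\mu\in\Gamma$ there are at most $g$ words $(\alpha_1,\ldots,\alpha_k)\in A^k$ with $\alpha_1\cdots\alpha_k=\mu$; an $S_k$-set is an $S_k[1]$-set. $M_{k,g}(\Gamma)$ is the maximum size of an $S_k[g]$-set in $\Gamma$, and $M_k(\Gamma)=M_{k,1}(\Gamma)$. $S_n$ and $A_n$ are the symmetric and alternating groups on $n$ letters. *)

theory Defs
  imports Complex_Main "HOL-Algebra.Sym_Groups"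
begin

definition word_prod :: "('a, 'b) monoid_scheme \<Rightarrow> 'a list \<Rightarrow> 'a" where
  "word_prod G w = foldr (mult G) w (one G)"

text \<open>
  Finiteness of the set of words is demanded explicitly, because the cardinality of an
  infinite set is 0 in HOL.
\<close>

definition S_set :: "('a, 'b) monoid_scheme \<Rightarrow> nat \<Rightarrow> nat \<Rightarrow> 'a set \<Rightarrow> bool" where
  "S_set G k g A \<longleftrightarrow>
     A \<subseteq> carrier G \<and>
     (\<forall>\<mu> \<in> carrier G.
        finite {w. length w = k \<and> set w \<subseteq> A \<and> word_prod G w = \<mu>} \<and>
        card {w. length w = k \<and> set w \<subseteq> A \<and> word_prod G w = \<mu>} \<le> g)"

text \<open>
  The maximum is taken as a natural number, so it is meaningful only for groups with
  finite carrier (where the set below is finite, and non-empty since the empty set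
  qualifies for positive \<open>k\<close>).
\<close>

definition max_S_set_size :: "nat \<Rightarrow> nat \<Rightarrow> ('a, 'b) monoid_scheme \<Rightarrow> nat" where
  "max_S_set_size k g G = Max {card A |A. S_set G k g A}"

abbreviation max_S1_set_size :: "nat \<Rightarrow> ('a, 'b) monoid_scheme \<Rightarrow> nat" where
  "max_S1_set_size k G \<equiv> max_S_set_size k 1 G"

end

theory Submission
  imports Defs "HOL-Combinatorics.Orbits"
begin

text \<open>
  Fix \<open>c\<close> and consider the pairs \<open>(x, x c)\<close>. If \<open>x y = \<mu>\<close> and \<open>x c y c = \<nu>\<close>, then
  \<open>x c x\<^sup>-\<^sup>1 = \<nu> c\<^sup>-\<^sup>1 \<mu>\<^sup>-\<^sup>1 = d\<close> depends only on \<open>(\<mu>, \<nu>)\<close>, and \<open>y\<close> is determined by \<open>x\<close>.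
  For permutations, \<open>x c = d x\<close> implies \<open>x (c\<^sup>j p) = d\<^sup>j (x p)\<close>; so if \<open>c\<close> is a cycle that passes
  through \<open>p\<close> and all other points but at most one, then \<open>x\<close> is determined by its value at \<open>p\<close>.
  Letting \<open>x\<close> range over the whole group gives at most \<open>n\<close> words, and letting it range over a
  largest fibre of \<open>x \<mapsto> x p\<close> gives at most one. Such a cycle exists already in the alternating
  group, since one of \<open>n\<close>, \<open>n - 1\<close> is odd.
\<close>

lemma card_le_max_S_set_size:
  assumes "finite (carrier G)" and "S_set G k g A"
  shows "card A \<le> max_S_set_size k g G"
proof -
  have "{card A |A. S_set G k g A} \<subseteq> card ` Pow (carrier G)"
    by (auto simp: S_set_def)
  then have "finite {card A |A. S_set G k g A}"
    using assms(1) finite_subset by fastforce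
  with assms(2) show ?thesis
    unfolding max_S_set_size_def by (intro Max_ge) auto
qed

definition transporter :: "('a, 'b) monoid_scheme \<Rightarrow> 'a \<Rightarrow> 'a \<Rightarrow> 'a set" where
  "transporter G c d = {x \<in> carrier G. x \<otimes>\<^bsub>G\<^esub> c = d \<otimes>\<^bsub>G\<^esub> x}"

definition twisted_diagonal :: "('a, 'b) monoid_scheme \<Rightarrow> 'a \<Rightarrow> 'a set \<Rightarrow> ('a \<times> 'a) set" where
  "twisted_diagonal G c B = (\<lambda>x. (x, x \<otimes>\<^bsub>G\<^esub> c)) ` B"

lemma card_twisted_diagonal: "card (twisted_diagonal G c B) = card B"
  by (simp add: twisted_diagonal_def card_image inj_on_def)

lemma (in group) twisted_diagonal_words_subset:
  assumes c: "c \<in> carrier G" and B: "B \<subseteq> carrier G"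
  shows "{w. length w = 2 \<and> set w \<subseteq> twisted_diagonal G c B \<and> word_prod (G \<times>\<times> G) w = (\<mu>, \<nu>)}
    \<subseteq> (\<lambda>x. [(x, x \<otimes> c), (inv x \<otimes> \<mu>, inv x \<otimes> \<mu> \<otimes> c)])
        ` (B \<inter> transporter G c (\<nu> \<otimes> inv c \<otimes> inv \<mu>))"
    (is "_ \<subseteq> ?word ` ?X")
proof clarify
  fix w :: "('a \<times> 'a) list"
  assume "length w = 2" and w_sub: "set w \<subseteq> twisted_diagonal G c B"
    and w_prod: "word_prod (G \<times>\<times> G) w = (\<mu>, \<nu>)"
  then obtain u v where "w = [u, v]"
    by (auto simp: numeral_2_eq_2 length_Suc_conv)
  with w_sub obtain x y where w: "w = [(x, x \<otimes> c), (y, y \<otimes> c)]" and xy_B: "x \<in> B" "y \<in> B"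
    by (auto simp: twisted_diagonal_def)
  have carr: "x \<in> carrier G" "y \<in> carrier G"
    using xy_B B by auto
  have \<mu>: "\<mu> = x \<otimes> y" and \<nu>: "\<nu> = (x \<otimes> c) \<otimes> (y \<otimes> c)"
    using w_prod w carr c by (simp_all add: word_prod_def)
  have "\<nu> \<otimes> inv c = (x \<otimes> c) \<otimes> y"
    using carr c by (simp add: \<nu> m_assoc)
  moreover have "y \<otimes> inv \<mu> = inv x"
    using carr by (simp add: \<mu> inv_mult_group m_assoc[symmetric])
  ultimately have "\<nu> \<otimes> inv c \<otimes> inv \<mu> = x \<otimes> c \<otimes> inv x"
    using carr c by (simp add: \<mu> m_assoc)
  then have "x \<in> transporter G c (\<nu> \<otimes> inv c \<otimes> inv \<mu>)"
    using carr c by (simp add: transporter_def m_assoc)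
  moreover have "y = inv x \<otimes> \<mu>"
    using carr by (simp add: \<mu> m_assoc[symmetric])
  ultimately show "w \<in> ?word ` ?X"
    using w xy_B by blast
qed

lemma (in group) S_set_twisted_diagonal:
  assumes c: "c \<in> carrier G" and B: "B \<subseteq> carrier G"
    and fin: "\<And>d. d \<in> carrier G \<Longrightarrow> finite (B \<inter> transporter G c d)"
    and card: "\<And>d. d \<in> carrier G \<Longrightarrow> card (B \<inter> transporter G c d) \<le> g"
  shows "S_set (G \<times>\<times> G) 2 g (twisted_diagonal G c B)"
  unfolding S_set_def
proof (intro conjI ballI)
  show "twisted_diagonal G c B \<subseteq> carrier (G \<times>\<times> G)"
    using B c by (auto simp: twisted_diagonal_def)
  fix m assume "m \<in> carrier (G \<times>\<times> G)"
  then obtain \<mu> \<nu> where m: "m = (\<mu>, \<nu>)" and carr: "\<mu> \<in> carrier G" "\<nu> \<in> carrier G"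
    by auto
  let ?W = "{w. length w = 2 \<and> set w \<subseteq> twisted_diagonal G c B \<and> word_prod (G \<times>\<times> G) w = m}"
  let ?T = "B \<inter> transporter G c (\<nu> \<otimes> inv c \<otimes> inv \<mu>)"
  note words = twisted_diagonal_words_subset[OF c B, of \<mu> \<nu>, folded m]
  have T: "finite ?T" "card ?T \<le> g"
    using fin card carr c by simp_all
  show "finite ?W"
    using T(1) words by (rule finite_surj)
  show "card ?W \<le> g"
    using surj_card_le[OF T(1) words] T(2) by (rule order_trans)
qed

lemma (in group) card_le_max_S_set_size_if_inj_on_transporters:
  assumes fin: "finite (carrier G)" and c: "c \<in> carrier G" and B: "B \<subseteq> carrier G"
    and Y: "finite Y" "h ` B \<subseteq> Y"
    and inj: "\<And>d. d \<in> carrier G \<Longrightarrow> inj_on h (transporter G c d)"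
  shows "card B \<le> max_S_set_size 2 (card Y) (G \<times>\<times> G)"
proof -
  have "S_set (G \<times>\<times> G) 2 (card Y) (twisted_diagonal G c B)"
  proof (rule S_set_twisted_diagonal[OF c B])
    fix d assume "d \<in> carrier G"
    then have "inj_on h (B \<inter> transporter G c d)"
      using inj by (blast intro: inj_on_subset)
    then show "card (B \<inter> transporter G c d) \<le> card Y"
      using Y by (intro card_inj_on_le) auto
    show "finite (B \<inter> transporter G c d)"
      using fin B by (blast intro: finite_subset)
  qed
  then show ?thesis
    using card_le_max_S_set_size[of "G \<times>\<times> G"] fin by (fastforce simp: card_twisted_diagonal)
qed

lemma (in group) order_le_max_S_set_size_if_inj_on_transporters:
  assumes fin: "finite (carrier G)" and c: "c \<in> carrier G"
    and Y: "finite Y" "h \<in> carrier G \<rightarrow> Y"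
    and inj: "\<And>d. d \<in> carrier G \<Longrightarrow> inj_on h (transporter G c d)"
  shows "order G \<le> max_S_set_size 2 (card Y) (G \<times>\<times> G)"
    and "order G \<le> card Y * max_S1_set_size 2 (G \<times>\<times> G)"
proof -
  show "order G \<le> max_S_set_size 2 (card Y) (G \<times>\<times> G)"
    unfolding order_def
    using Y by (intro card_le_max_S_set_size_if_inj_on_transporters[OF fin c _ _ _ inj]) auto
  have "Y \<noteq> {}"
    using Y(2) one_closed by blast
  then obtain q where fibre: "order G \<le> card (h -` {q} \<inter> carrier G) * card Y"
    using pigeonhole_card[OF Y(2) fin Y(1)] by (auto simp: order_def)
  have "card (h -` {q} \<inter> carrier G) \<le> max_S_set_size 2 (card {q}) (G \<times>\<times> G)"
    by (intro card_le_max_S_set_size_if_inj_on_transporters[OF fin c _ _ _ inj]) auto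
  then have "card (h -` {q} \<inter> carrier G) * card Y \<le> card Y * max_S1_set_size 2 (G \<times>\<times> G)"
    by simp
  with fibre show "order G \<le> card Y * max_S1_set_size 2 (G \<times>\<times> G)"
    by (rule order_trans)
qed

lemma cyclic_on_cycle_of_list:
  assumes "distinct cs" and "cs \<noteq> []"
  shows "cyclic_on (cycle_of_list cs) (set cs)"
proof -
  let ?c = "cycle_of_list cs"
  have "x \<in> orbit ?c (hd cs)" if "x \<in> set cs" for x
  proof -
    from that obtain i where i: "i < length cs" "x = cs ! i"
      by (auto simp: in_set_conv_nth)
    have "(?c ^^ i) (hd cs) = map (?c ^^ i) cs ! 0"
      using assms(2) by (simp add: hd_conv_nth)
    also have "\<dots> = x"
      using i assms(2) by (simp add: cyclic_rotation[OF assms(1)] nth_rotate)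
    finally show ?thesis
      by (auto simp: orbit_altdef_permutation[OF permutation_of_cycle])
  qed
  moreover have "orbit ?c (hd cs) \<subseteq> set cs"
    using cycle_permutes assms(2) by (intro permutes_orbit_subset) auto
  ultimately show ?thesis
    using assms(2) unfolding cyclic_on_def by (intro bexI[of _ "hd cs"]) auto
qed

lemma evenperm_cycle_of_list:
  assumes "distinct cs"
  shows "evenperm (cycle_of_list cs) \<longleftrightarrow> even (length cs - 1)"
  using assms
proof (induction cs rule: cycle_of_list.induct)
  case (1 i j cs)
  have "evenperm (cycle_of_list (i # j # cs)) \<longleftrightarrow> \<not> evenperm (cycle_of_list (j # cs))"
    using "1.prems" evenperm_comp[OF permutation_swap_id permutation_of_cycle, of i j "j # cs"]
    by (simp add: evenperm_swap del: o_apply)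
  then show ?case
    using 1 by (simp del: o_apply)
qed simp_all

lemma intertwiners_agree_on_cycle:
  assumes "cyclic_on c T" and "p \<in> T" and "q \<in> T"
    and x: "x \<circ> c = d \<circ> x" and y: "y \<circ> c = d \<circ> y" and p: "x p = y p"
  shows "x q = y q"
proof -
  have step: "x (c r) = y (c r)" if "x r = y r" for r
    using fun_cong[OF x, of r] fun_cong[OF y, of r] that by simp
  have "q \<in> orbit c p"
    using assms(1-3) by (auto simp: cyclic_on_alldef)
  then show ?thesis
    by induction (use p step in auto)
qed

lemma permutes_eqI_except_one:
  assumes x: "x permutes S" and y: "y permutes S"
    and eq: "\<And>q. \<lbrakk>q \<in> S; q \<noteq> b\<rbrakk> \<Longrightarrow> x q = y q"
  shows "x = y"
proof -
  have "(inv' y \<circ> x) permutes {b}"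
  proof (rule permutes_superset)
    show "(inv' y \<circ> x) permutes S"
      using x y by (intro permutes_compose permutes_inv)
    show "(inv' y \<circ> x) q = q" if "q \<in> S - {b}" for q
      using that eq permutes_inverses[OF y] by simp
  qed
  then have "y \<circ> (inv' y \<circ> x) = y"
    by simp
  then show ?thesis
    by (simp add: o_assoc permutes_inv_o[OF y])
qed

lemma inj_on_eval_intertwining_permutations:
  assumes "cyclic_on c T" and "p \<in> T" and "S \<subseteq> insert b T"
  shows "inj_on (\<lambda>x. x p) {x. x permutes S \<and> x \<circ> c = d \<circ> x}"
proof (rule inj_onI, clarify)
  fix x y
  assume x: "x permutes S" and y: "y permutes S"
    and agree: "x \<circ> c = d \<circ> x" "y \<circ> c = d \<circ> y" "x p = y p"
  show "x = y"
  proof (rule permutes_eqI_except_one[OF x y])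
    fix q assume "q \<in> S" "q \<noteq> b"
    then have "q \<in> T"
      using assms(3) by auto
    then show "x q = y q"
      using agree by (rule intertwiners_agree_on_cycle[OF assms(1,2)])
  qed
qed

lemma card_permutation_group_le_max_S_set_size:
  assumes H: "subgroup H (sym_group n)" and c: "c \<in> H" "cyclic_on c T"
    and T: "T \<subseteq> {1..n}" "{1..n} \<subseteq> insert b T"
  defines "G \<equiv> sym_group n\<lparr>carrier := H\<rparr>"
  shows "card H \<le> max_S_set_size 2 n (G \<times>\<times> G)"
    and "card H \<le> n * max_S1_set_size 2 (G \<times>\<times> G)"
proof -
  have H_permutes: "x permutes {1..n}" if "x \<in> H" for x
    using subgroup.subset[OF H] that by (auto simp: sym_group_carrier)
  interpret group G
    unfolding G_def using H by (rule group.subgroup_imp_group[OF sym_group_is_group])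
  have carrier_G: "carrier G = H"
    by (simp add: G_def)
  have fin: "finite (carrier G)"
    using H_permutes by (auto simp: carrier_G intro: finite_subset[OF _ finite_permutations])
  obtain p where p: "p \<in> T"
    using c(2) by (auto simp: cyclic_on_def)
  have maps: "(\<lambda>x. x p) \<in> carrier G \<rightarrow> {1..n}"
    using p T(1) by (auto simp: carrier_G permutes_in_image[OF H_permutes, simplified])
  have inj: "inj_on (\<lambda>x. x p) (transporter G c d)" for d
  proof (rule inj_on_subset[OF inj_on_eval_intertwining_permutations[OF c(2) p T(2)]])
    show "transporter G c d \<subseteq> {x. x permutes {1..n} \<and> x \<circ> c = d \<circ> x}"
      using H_permutes by (auto simp: transporter_def G_def sym_group_mult)
  qed
  note bounds = order_le_max_S_set_size_if_inj_on_transporters[OF fin _ _ maps inj]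
  show "card H \<le> max_S_set_size 2 n (G \<times>\<times> G)"
    and "card H \<le> n * max_S1_set_size 2 (G \<times>\<times> G)"
    using bounds c(1) by (simp_all add: order_def carrier_G)
qed

lemma alt_group_cycle_missing_at_most_one_point:
  assumes "n \<ge> 1"
  obtains c T where "c \<in> carrier (alt_group n)" and "cyclic_on c T"
    and "T \<subseteq> {1..n}" and "{1..n} \<subseteq> insert n T"
proof -
  define k where "k = (if odd n then n else n - 1)"
  have k: "odd k" "k \<ge> 1" "k \<le> n" "n \<le> Suc k"
    using assms by (auto simp: k_def)
  let ?cs = "[1..<Suc k]"
  have set_cs: "set ?cs = {1..k}"
    by auto
  have "cycle_of_list ?cs permutes {1..n}"
    using cycle_permutes by (rule permutes_subset) (use k in auto)
  moreover have "evenperm (cycle_of_list ?cs)"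
    using k by (subst evenperm_cycle_of_list) auto
  ultimately have "cycle_of_list ?cs \<in> carrier (alt_group n)"
    by (simp add: alt_group_carrier)
  moreover have "cyclic_on (cycle_of_list ?cs) {1..k}"
    using cyclic_on_cycle_of_list[of ?cs] k(2) unfolding set_cs by simp
  ultimately show thesis
    using k by (intro that[of _ "{1..k}"]) auto
qed

lemma fact_le_card_alt_group: "fact n \<le> 2 * card (carrier (alt_group n))"
proof (cases "n \<ge> 2")
  case True
  then show ?thesis
    by (simp add: alt_group_card_carrier)
next
  case False
  have "finite (carrier (alt_group n))"
    by (rule finite_subset[OF _ finite_permutations[of "{1..n}"]]) (auto simp: alt_group_carrier)
  moreover have "id \<in> carrier (alt_group n)"
    by (simp add: alt_group_carrier permutes_id)
  ultimately have "card (carrier (alt_group n)) > 0"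
    by (auto simp: card_gt_0_iff)
  moreover have "fact n = (1 :: nat)"
    using False by (cases "n = 0") (auto simp: not_le less_2_cases_iff)
  ultimately show ?thesis
    by linarith
qed

lemma fact_le_mult_max_S_set_size:
  assumes n: "n \<ge> 1" and H: "subgroup H (sym_group n)" and alt: "carrier (alt_group n) \<subseteq> H"
    and index: "fact n \<le> i * card H"
  defines "G \<equiv> sym_group n\<lparr>carrier := H\<rparr>"
  shows "fact n \<le> i * max_S_set_size 2 n (G \<times>\<times> G)"
    and "fact (n - 1) \<le> i * max_S1_set_size 2 (G \<times>\<times> G)"
proof -
  obtain c T where "c \<in> carrier (alt_group n)" and cycle: "cyclic_on c T"
    and T: "T \<subseteq> {1..n}" "{1..n} \<subseteq> insert n T"
    using n by (rule alt_group_cycle_missing_at_most_one_point)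
  then have c: "c \<in> H"
    using alt by blast
  note bounds = card_permutation_group_le_max_S_set_size[OF H c cycle T, folded G_def]
  show "fact n \<le> i * max_S_set_size 2 n (G \<times>\<times> G)"
    using index mult_le_mono2[OF bounds(1)] by (rule order_trans)
  have "fact n \<le> i * (n * max_S1_set_size 2 (G \<times>\<times> G))"
    using index mult_le_mono2[OF bounds(2)] by (rule order_trans)
  then have "n * fact (n - 1) \<le> n * (i * max_S1_set_size 2 (G \<times>\<times> G))"
    using n by (simp add: fact_reduce mult.left_commute)
  then show "fact (n - 1) \<le> i * max_S1_set_size 2 (G \<times>\<times> G)"
    using n by simp
qed

theorem theorem1p8:
  fixes n :: nat
  assumes "n \<ge> 1"
  shows "max_S1_set_size 2 (sym_group n \<times>\<times> sym_group n) \<ge> fact (n - 1) \<and>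
         max_S_set_size 2 n (sym_group n \<times>\<times> sym_group n) \<ge> fact n \<and>
         real (max_S1_set_size 2 (alt_group n \<times>\<times> alt_group n)) \<ge> fact (n - 1) / 2 \<and>
         real (max_S_set_size 2 n (alt_group n \<times>\<times> alt_group n)) \<ge> fact n / 2"
proof -
  have alt_le_sym: "carrier (alt_group n) \<subseteq> carrier (sym_group n)"
    by (rule subgroup.subset[OF alt_group_is_subgroup])
  have sym: "fact n \<le> max_S_set_size 2 n (sym_group n \<times>\<times> sym_group n)"
    "fact (n - 1) \<le> max_S1_set_size 2 (sym_group n \<times>\<times> sym_group n)"
    using fact_le_mult_max_S_set_size
      [OF assms group.subgroup_self[OF sym_group_is_group] alt_le_sym, of 1]
    by (simp_all add: sym_group_card_carrier)
  have alt: "fact n \<le> 2 * max_S_set_size 2 n (alt_group n \<times>\<times> alt_group n)"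
    "fact (n - 1) \<le> 2 * max_S1_set_size 2 (alt_group n \<times>\<times> alt_group n)"
    using fact_le_mult_max_S_set_size
      [OF assms alt_group_is_subgroup subset_refl fact_le_card_alt_group]
    by (simp_all add: alt_group_def)
  have half: "real k \<ge> fact m / 2" if "fact m \<le> 2 * k" for k m :: nat
    using of_nat_mono[OF that, where 'a = real] by simp
  show ?thesis
    using sym alt[THEN half] by blast
qed

end
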